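(* Let $\varphi$ be a (possibly constant) linear-fractional selfmap of the open unit disk $\mathbb{D}$, and let $C_\varphi^*$ be the adjoint of the composition operator $C_\varphi:H^2\to H^2$. The constant function $1$ is in the range of $C_\varphi^*$ if and only if $\varphi(\beta)=0$ for some $\beta\in\mathbb{D}$.
   Context: $H^2$ is the Hilbert space of analytic functions $f(z)=\sum_{n\ge 0}a_nz^n$ on $\mathbb{D}$ with $\|f\|^2=\sum|a_n|^2<\infty$, and $C_\varphi f=f\circ\varphi$ (bounded on $H^2$). A linear-fractional selfmap of $\mathbb{D}$ is a map $\varphi(z)=\frac{az+b}{cz+d}$ with $\varphi(\mathbb{D})\subseteq\mathbb{D}$; constant maps are allowed here. *)

theory Defs
  imports "HOL-Complex_Analysis.Complex_Analysis"
begin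

text \<open>
  Functions on the open unit disk are represented by functions on \<^typ>\<open>complex\<close> that vanish
  outside the disk, so that two elements of the Hardy space are equal iff they agree on the disk.
\<close>

definition on_disk :: "(complex \<Rightarrow> complex) \<Rightarrow> complex \<Rightarrow> complex" where
  "on_disk f = (\<lambda>z. if z \<in> ball 0 1 then f z else 0)"

definition taylor_coeff :: "(complex \<Rightarrow> complex) \<Rightarrow> nat \<Rightarrow> complex" where
  "taylor_coeff f n = fps_nth (fps_expansion f 0) n"

definition H2 :: "(complex \<Rightarrow> complex) set" where
  "H2 = {f. f holomorphic_on ball 0 1 \<and> (\<forall>z. z \<notin> ball 0 1 \<longrightarrow> f z = 0) \<and>
            summable (\<lambda>n. (cmod (taylor_coeff f n))\<^sup>2)}"

definition H2_inner :: "(complex \<Rightarrow> complex) \<Rightarrow> (complex \<Rightarrow> complex) \<Rightarrow> complex" where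
  "H2_inner f g = (\<Sum>n. taylor_coeff f n * cnj (taylor_coeff g n))"

definition comp_op :: "(complex \<Rightarrow> complex) \<Rightarrow> (complex \<Rightarrow> complex) \<Rightarrow> complex \<Rightarrow> complex" where
  "comp_op \<phi> f = on_disk (f \<circ> \<phi>)"

text \<open>
  The Hilbert space adjoint of an operator on \<^const>\<open>H2\<close>. The element described exists and is
  unique for every \<open>g\<close> in \<^const>\<open>H2\<close> whenever \<open>T\<close> is a bounded linear operator on \<^const>\<open>H2\<close>;
  composition operators induced by holomorphic selfmaps of the disk are bounded (Littlewood).
\<close>

definition H2_adjoint ::
    "((complex \<Rightarrow> complex) \<Rightarrow> complex \<Rightarrow> complex) \<Rightarrow> (complex \<Rightarrow> complex) \<Rightarrow> complex \<Rightarrow> complex" where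
  "H2_adjoint T g = (THE h. h \<in> H2 \<and> (\<forall>f\<in>H2. H2_inner (T f) g = H2_inner f h))"

text \<open>
  The condition \<open>a * d - b * c \<noteq> 0\<close> is not imposed, so constant maps are included. The denominator
  must not vanish on the disk, because division by zero yields \<open>0\<close> in HOL and a pole inside the
  disk would otherwise go unnoticed. Values of \<open>\<phi>\<close> outside the disk are irrelevant.
\<close>

definition linear_fractional_selfmap :: "(complex \<Rightarrow> complex) \<Rightarrow> bool" where
  "linear_fractional_selfmap \<phi> \<longleftrightarrow>
     (\<exists>a b c d. \<forall>z\<in>ball 0 1. c * z + d \<noteq> 0 \<and> \<phi> z = moebius a b c d z) \<and>
     \<phi> ` ball 0 1 \<subseteq> ball 0 1"

end

theory Submission
  imports Defs
begin

text \<open>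
  If \<open>\<phi> \<beta> = 0\<close>, the reproducing kernel at \<open>\<beta>\<close> is mapped to the kernel at \<open>0\<close>, which is \<open>1\<close>.
  Conversely, if \<open>1\<close> is the image of \<open>g\<close>, then \<open>\<langle>f \<circ> \<phi>, g\<rangle> = f 0\<close> for all \<open>f\<close>. If \<open>\<phi>\<close> has no zero,
  its image, a disk or a point, lies in \<open>{w. cmod (w - p) < cmod p}\<close> for some \<open>p\<close>, so
  \<open>\<psi> = 1 - \<phi> / p\<close> is a selfmap of the disk. Taking \<open>f w = (1 - w / p) ^ k\<close> gives \<open>\<langle>\<psi> ^ k, g\<rangle> = 1\<close> for
  all \<open>k\<close>, but \<open>\<psi> ^ k\<close> is bounded in the Hardy space and tends to \<open>0\<close> coefficientwise, hence weakly.

  The existence of the adjoint needs the boundedness of the composition operator (Littlewood), which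
  is proved for polynomials by induction on the degree and passes to the limit.
\<close>

abbreviation unit_disk :: "complex set" where "unit_disk \<equiv> ball 0 1"

abbreviation square_summable :: "(nat \<Rightarrow> complex) \<Rightarrow> bool" where
  "square_summable a \<equiv> summable (\<lambda>n. (cmod (a n))\<^sup>2)"

abbreviation sq_norm :: "(nat \<Rightarrow> complex) \<Rightarrow> real" where
  "sq_norm a \<equiv> (\<Sum>n. (cmod (a n))\<^sup>2)"

section \<open>Orthogonality of characters and Parseval for trigonometric polynomials\<close>

lemma has_integral_cis_int:
  "((\<lambda>t. cis (of_int k * t)) has_integral (if k = 0 then of_real (2 * pi) else 0)) {0..2 * pi}"
proof (cases "k = 0")
  case True
  then show ?thesis
    using has_integral_const_real[of "1::complex" 0 "2 * pi"] by (simp add: scaleR_conv_of_real)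
next
  case False
  let ?F = "\<lambda>t. cis (of_int k * t) / (\<i> * of_int k)"
  have "((\<lambda>t. cis (of_int k * t)) has_integral (?F (2 * pi) - ?F 0)) {0..2 * pi}"
  proof (rule fundamental_theorem_of_calculus)
    fix t :: real
    have "((\<lambda>z. exp (\<i> * of_int k * z) / (\<i> * of_int k)) has_field_derivative exp (\<i> * of_int k * of_real t))
            (at (of_real t))"
      using False by (auto intro!: derivative_eq_intros)
    from has_vector_derivative_real_field[OF this]
    show "(?F has_vector_derivative cis (of_int k * t)) (at t within {0..2 * pi})"
      by (simp add: cis_conv_exp mult_ac)
  qed simp
  moreover have "cis (of_int k * (2 * pi)) = 1"
    by (metis cis_multiple_2pi Ints_of_int mult.commute)
  ultimately show ?thesis using False by simp
qed

text \<open>Expanding the squared modulus as a double sum gives characters with exponent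
  \<open>int m - int n\<close>, and orthogonality keeps only the diagonal.\<close>

lemma parseval_finite:
  "((\<lambda>t. (cmod (\<Sum>n<N. b n * cis (real n * t)))\<^sup>2) has_integral (2 * pi * (\<Sum>n<N. (cmod (b n))\<^sup>2)))
     {0..2 * pi}"
proof -
  have "((\<lambda>t. \<Sum>m<N. \<Sum>n<N. b m * cnj (b n) * cis (of_int (int m - int n) * t)) has_integral
          (\<Sum>m<N. \<Sum>n<N. b m * cnj (b n) * (if int m - int n = 0 then of_real (2 * pi) else 0))) {0..2 * pi}"
    by (intro has_integral_sum has_integral_mult_right has_integral_cis_int finite_lessThan)
  also have "(\<lambda>t. \<Sum>m<N. \<Sum>n<N. b m * cnj (b n) * cis (of_int (int m - int n) * t)) =
             (\<lambda>t. of_real ((cmod (\<Sum>n<N. b n * cis (real n * t)))\<^sup>2))"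
    by (rule ext, subst complex_norm_square, subst cnj_sum, subst sum_product)
       (simp add: cis_cnj algebra_simps cis_mult flip: cis_divide)
  also have "(\<Sum>m<N. \<Sum>n<N. b m * cnj (b n) * (if int m - int n = 0 then of_real (2 * pi) else 0)) =
             (\<Sum>m<N. of_real ((cmod (b m))\<^sup>2 * (2 * pi)))"
    by (rule sum.cong) (auto simp: complex_norm_square if_distrib simp del: of_real_power cong: if_cong)
  finally have "((\<lambda>t. complex_of_real ((cmod (\<Sum>n<N. b n * cis (real n * t)))\<^sup>2)) has_integral
                  complex_of_real (\<Sum>m<N. (cmod (b m))\<^sup>2 * (2 * pi))) {0..2 * pi}"
    by simp
  from has_integral_linear[OF this bounded_linear_Re] show ?thesis
    by (simp add: o_def sum_distrib_left mult_ac)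
qed

section \<open>Taylor coefficients of functions on the disk\<close>

lemma taylor_coeff_eq_deriv: "taylor_coeff f n = (deriv ^^ n) f 0 / fact n"
  by (simp add: taylor_coeff_def fps_expansion_def)

lemma taylor_coeff_0: "taylor_coeff f 0 = f 0"
  by (simp add: taylor_coeff_eq_deriv)

text \<open>Coefficients depend only on the germ at \<open>0\<close>; this makes the truncation by
  \<open>on_disk\<close> invisible to them.\<close>

lemma taylor_coeff_cong:
  assumes "\<And>z. z \<in> unit_disk \<Longrightarrow> f z = g z"
  shows "taylor_coeff f = taylor_coeff g"
proof -
  have "eventually (\<lambda>z. f z = g z) (nhds 0)"
    using assms by (intro eventually_nhds_in_open[of unit_disk, THEN eventually_mono]) auto
  then show ?thesis
    using fps_expansion_cong[of f g 0] by (simp add: taylor_coeff_def fun_eq_iff)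
qed

lemma taylor_coeff_on_disk [simp]: "taylor_coeff (on_disk f) = taylor_coeff f"
  by (rule taylor_coeff_cong) (simp add: on_disk_def)

lemma holomorphic_on_disk_iff [simp]: "on_disk f holomorphic_on unit_disk \<longleftrightarrow> f holomorphic_on unit_disk"
  by (rule holomorphic_cong) (auto simp: on_disk_def)

lemma on_disk_in_H2_iff:
  "on_disk f \<in> H2 \<longleftrightarrow> f holomorphic_on unit_disk \<and> square_summable (taylor_coeff f)"
proof -
  have "on_disk f z = 0" if "z \<notin> unit_disk" for z
    using that by (simp add: on_disk_def)
  then show ?thesis
    unfolding H2_def by simp
qed

lemma taylor_series_sums:
  assumes "f holomorphic_on unit_disk" "z \<in> unit_disk"
  shows "(\<lambda>n. taylor_coeff f n * z ^ n) sums f z"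
  using holomorphic_power_series[OF assms] by (simp add: taylor_coeff_eq_deriv)

lemma taylor_coeff_unique:
  assumes "\<And>z. z \<in> unit_disk \<Longrightarrow> (\<lambda>n. a n * z ^ n) sums f z"
  shows "taylor_coeff f = a"
proof -
  have "f has_fps_expansion Abs_fps a"
    using assms by (intro has_fps_expansionI eventually_nhds_in_open[of unit_disk, THEN eventually_mono]) auto
  then show ?thesis
    by (simp add: taylor_coeff_def fps_expansion_eqI fun_eq_iff)
qed

lemma holomorphic_of_power_series:
  assumes "\<And>z. z \<in> unit_disk \<Longrightarrow> (\<lambda>n. a n * z ^ n) sums f z"
  shows "f holomorphic_on unit_disk"
  using assms power_series_holomorphic[of 0 1 a f] by simp

lemma taylor_coeff_add:
  assumes "f holomorphic_on unit_disk" "g holomorphic_on unit_disk"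
  shows "taylor_coeff (\<lambda>z. f z + g z) = (\<lambda>n. taylor_coeff f n + taylor_coeff g n)"
  by (rule taylor_coeff_unique) (auto simp: ring_distribs intro!: sums_add taylor_series_sums assms)

lemma taylor_coeff_const: "taylor_coeff (\<lambda>_. c) = (\<lambda>n. if n = 0 then c else 0)"
proof (rule taylor_coeff_unique)
  fix z :: complex
  have "(\<lambda>n. (if n = 0 then c else 0) * z ^ n) = (\<lambda>n. if n = 0 then c else 0)" by auto
  then show "(\<lambda>n. (if n = 0 then c else 0) * z ^ n) sums c"
    using sums_single[of 0 "\<lambda>n. c"] by simp
qed

lemma taylor_coeff_cmult:
  assumes "f holomorphic_on unit_disk"
  shows "taylor_coeff (\<lambda>z. c * f z) = (\<lambda>n. c * taylor_coeff f n)"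
  by (rule taylor_coeff_unique) (auto simp: mult.assoc intro!: sums_mult taylor_series_sums assms)

lemma taylor_coeff_sum:
  assumes "\<And>k. k \<in> A \<Longrightarrow> f k holomorphic_on unit_disk"
  shows "taylor_coeff (\<lambda>z. \<Sum>k\<in>A. f k z) = (\<lambda>n. \<Sum>k\<in>A. taylor_coeff (f k) n)"
  by (rule taylor_coeff_unique) (auto simp: sum_distrib_right intro!: sums_sum taylor_series_sums assms)

lemma taylor_coeff_poly: "taylor_coeff (poly p) = coeff p"
proof (rule taylor_coeff_unique)
  fix z :: complex
  show "(\<lambda>n. coeff p n * z ^ n) sums poly p z"
    unfolding poly_altdef by (rule sums_finite) (auto simp: coeff_eq_0)
qed

section \<open>Uniform convergence and Parseval's identity on circles of radius below 1\<close>

lemma taylor_conv_radius: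
  assumes "f holomorphic_on unit_disk"
  shows "conv_radius (taylor_coeff f) \<ge> 1"
proof (rule conv_radius_geI_ex')
  fix r :: real assume "0 < r" "ereal r < 1"
  then show "summable (\<lambda>n. taylor_coeff f n * of_real r ^ n)"
    using sums_summable[OF taylor_series_sums[OF assms, of "of_real r"]] by simp
qed

lemma taylor_uniform_limit:
  assumes "f holomorphic_on unit_disk" "r < 1"
  shows "uniform_limit (cball 0 r) (\<lambda>N z. \<Sum>n<N. taylor_coeff f n * z ^ n) f sequentially"
proof -
  have r: "ereal r < conv_radius (taylor_coeff f)"
    by (rule less_le_trans[OF _ taylor_conv_radius]) (use assms in auto)
  have eq: "(\<Sum>n. taylor_coeff f n * z ^ n) = f z" if "z \<in> cball 0 r" for z
    using that assms(2) by (intro sums_unique[symmetric] taylor_series_sums assms(1)) auto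
  show ?thesis
    by (rule uniform_limit_cong'[THEN iffD1, OF _ _ powser_uniform_limit[OF r, of 0]])
       (use eq in auto)
qed

text \<open>On a circle inside the disk the Taylor partial sums converge uniformly, so the finite
  Parseval identity passes to the limit. Staying at \<open>r < 1\<close> avoids boundary
  values.\<close>

lemma parseval_circle:
  assumes f: "f holomorphic_on unit_disk" and r: "0 \<le> r" "r < 1"
  obtains J where "((\<lambda>t. (cmod (f (of_real r * cis t)))\<^sup>2) has_integral J) {0..2 * pi}"
    and "(\<lambda>n. 2 * pi * (cmod (taylor_coeff f n))\<^sup>2 * r ^ (2 * n)) sums J"
proof -
  define S where "S = (\<lambda>N t. \<Sum>n<N. (taylor_coeff f n * of_real r ^ n) * cis (real n * t))"
  have ul: "uniform_limit {0..2 * pi} S (\<lambda>t. f (of_real r * cis t)) sequentially"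
  proof -
    have "uniform_limit {0..2 * pi} (\<lambda>N t. \<Sum>n<N. taylor_coeff f n * (of_real r * cis t) ^ n)
            (\<lambda>t. f (of_real r * cis t)) sequentially"
      by (rule uniform_limit_compose'[OF taylor_uniform_limit[OF f r(2)]])
         (use r in \<open>auto simp: norm_mult\<close>)
    then show ?thesis
      unfolding S_def power_mult_distrib Complex.DeMoivre mult.assoc .
  qed
  have cont: "continuous_on {0..2 * pi} (\<lambda>t. f (of_real r * cis t))"
    by (rule continuous_on_compose2[OF holomorphic_on_imp_continuous_on[OF f]])
       (use r in \<open>auto intro!: continuous_intros simp: norm_mult\<close>)
  \<comment> \<open>Squaring preserves uniform convergence because the limit function is bounded,
    being continuous on a compact interval.\<close>
  have "uniform_limit {0..2 * pi} (\<lambda>N t. (cmod (S N t))\<^sup>2) (\<lambda>t. (cmod (f (of_real r * cis t)))\<^sup>2) sequentially"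
    unfolding power2_eq_square
    using compact_imp_bounded[OF compact_continuous_image[OF cont]]
    by (intro uniform_lim_mult uniform_limit_intros ul)
       (auto simp: bounded_iff)
  moreover have "continuous_on {0..2 * pi} (\<lambda>t. (cmod (S N t))\<^sup>2)" for N
    unfolding S_def by (intro continuous_intros)
  ultimately obtain I J where
    I: "\<And>N. ((\<lambda>t. (cmod (S N t))\<^sup>2) has_integral I N) {0..2 * pi}"
    and J: "((\<lambda>t. (cmod (f (of_real r * cis t)))\<^sup>2) has_integral J) {0..2 * pi}"
    and lim: "I \<longlonglongrightarrow> J"
    by (rule uniform_limit_integral) auto
  have "I N = (\<Sum>n<N. 2 * pi * (cmod (taylor_coeff f n))\<^sup>2 * r ^ (2 * n))" for N
    by (rule has_integral_unique[OF I[of N, unfolded S_def] parseval_finite, THEN trans])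
       (use r in \<open>simp add: sum_distrib_left norm_mult norm_power power_mult_distrib mult_ac flip: power_mult\<close>)
  then have "I = (\<lambda>N. \<Sum>n<N. 2 * pi * (cmod (taylor_coeff f n))\<^sup>2 * r ^ (2 * n))"
    by (rule ext)
  with lim have "(\<lambda>n. 2 * pi * (cmod (taylor_coeff f n))\<^sup>2 * r ^ (2 * n)) sums J"
    by (simp add: sums_def)
  with J show thesis by (rule that)
qed

section \<open>Bounded multipliers on the Hardy space\<close>

lemma sum_le_suminf_sq:
  assumes "square_summable a"
  shows "(\<Sum>n<N. (cmod (a n))\<^sup>2) \<le> sq_norm a"
  by (rule sum_le_suminf[OF assms]) auto

lemma square_summable_bounded_sums:
  assumes "\<And>N. (\<Sum>n<N. (cmod (a n))\<^sup>2) \<le> B"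
  shows "square_summable a" "sq_norm a \<le> B"
proof -
  show "square_summable a"
    by (rule summableI_nonneg_bounded[of _ B]) (use assms in auto)
  then show "sq_norm a \<le> B"
    by (intro suminf_le_const assms)
qed

text \<open>The pointwise bound on \<open>\<phi>\<close> compares the mean squares of
  \<open>\<phi> * f\<close> and \<open>f\<close> on each circle, and Parseval turns this into a
  bound on coefficients weighted by \<open>r ^ (2 * n)\<close>.\<close>

lemma H2_multiplier_contraction:
  assumes \<phi>: "\<phi> holomorphic_on unit_disk" "\<And>z. z \<in> unit_disk \<Longrightarrow> cmod (\<phi> z) \<le> 1"
    and f: "f holomorphic_on unit_disk" "square_summable (taylor_coeff f)"
  shows "square_summable (taylor_coeff (\<lambda>z. \<phi> z * f z))"
    and "sq_norm (taylor_coeff (\<lambda>z. \<phi> z * f z)) \<le> sq_norm (taylor_coeff f)"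
proof -
  let ?g = "\<lambda>z. \<phi> z * f z"
  have g: "?g holomorphic_on unit_disk"
    by (intro holomorphic_intros \<phi> f)
  have *: "(\<Sum>n<N. (cmod (taylor_coeff ?g n))\<^sup>2 * r ^ (2 * n)) \<le> sq_norm (taylor_coeff f)"
    if r: "0 \<le> r" "r < 1" for r N
  proof -
    obtain I where I: "((\<lambda>t. (cmod (?g (of_real r * cis t)))\<^sup>2) has_integral I) {0..2 * pi}"
        "(\<lambda>n. 2 * pi * (cmod (taylor_coeff ?g n))\<^sup>2 * r ^ (2 * n)) sums I"
      by (rule parseval_circle[OF g r])
    obtain J where J: "((\<lambda>t. (cmod (f (of_real r * cis t)))\<^sup>2) has_integral J) {0..2 * pi}"
        "(\<lambda>n. 2 * pi * (cmod (taylor_coeff f n))\<^sup>2 * r ^ (2 * n)) sums J"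
      by (rule parseval_circle[OF f(1) r])
    have "2 * pi * (\<Sum>n<N. (cmod (taylor_coeff ?g n))\<^sup>2 * r ^ (2 * n)) =
          (\<Sum>n<N. 2 * pi * (cmod (taylor_coeff ?g n))\<^sup>2 * r ^ (2 * n))"
      by (simp add: sum_distrib_left mult.assoc)
    also have "\<dots> \<le> I"
      unfolding sums_unique[OF I(2)]
      by (rule sum_le_suminf[OF sums_summable[OF I(2)]]) (use r in auto)
    also have "I \<le> J"
    proof (rule has_integral_le[OF I(1) J(1)])
      fix t
      have "cmod (\<phi> (of_real r * cis t)) \<le> 1"
        using r by (intro \<phi>(2)) (simp add: norm_mult)
      then have "cmod (?g (of_real r * cis t)) \<le> cmod (f (of_real r * cis t))"
        unfolding norm_mult by (rule mult_left_le_one_le[rotated 2]) auto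
      then show "(cmod (?g (of_real r * cis t)))\<^sup>2 \<le> (cmod (f (of_real r * cis t)))\<^sup>2"
        by (intro power_mono) auto
    qed
    also have "J \<le> 2 * pi * sq_norm (taylor_coeff f)"
    proof (rule sums_le[OF _ J(2)])
      show "(\<lambda>n. 2 * pi * (cmod (taylor_coeff f n))\<^sup>2) sums (2 * pi * sq_norm (taylor_coeff f))"
        by (intro sums_mult summable_sums f)
      show "2 * pi * (cmod (taylor_coeff f n))\<^sup>2 * r ^ (2 * n) \<le> 2 * pi * (cmod (taylor_coeff f n))\<^sup>2" for n
        using r by (intro mult_right_le_one_le) (auto simp: power_le_one)
    qed
    finally show ?thesis by simp
  qed
  \<comment> \<open>With \<open>N\<close> fixed the sum is finite, so the weights can be removed by
    letting \<open>r\<close> tend to 1 term by term.\<close>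
  have "(\<Sum>n<N. (cmod (taylor_coeff ?g n))\<^sup>2) \<le> sq_norm (taylor_coeff f)" for N
  proof (rule tendsto_upperbound)
    show "((\<lambda>r. \<Sum>n<N. (cmod (taylor_coeff ?g n))\<^sup>2 * r ^ (2 * n)) \<longlongrightarrow>
            (\<Sum>n<N. (cmod (taylor_coeff ?g n))\<^sup>2)) (at_left (1::real))"
      by (auto intro!: tendsto_eq_intros sum.cong)
    show "eventually (\<lambda>r. (\<Sum>n<N. (cmod (taylor_coeff ?g n))\<^sup>2 * r ^ (2 * n)) \<le> sq_norm (taylor_coeff f))
            (at_left (1::real))"
      using eventually_at_left_real[of 0 1] by (auto elim!: eventually_mono intro: *)
  qed simp
  then show "square_summable (taylor_coeff ?g)" "sq_norm (taylor_coeff ?g) \<le> sq_norm (taylor_coeff f)"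
    by (rule square_summable_bounded_sums)+
qed

section \<open>Littlewood's subordination theorem\<close>

definition littlewood_const :: "complex \<Rightarrow> real" where
  "littlewood_const w = 2 + 4 * (cmod w)\<^sup>2 / (1 - (cmod w)\<^sup>2)"

lemma littlewood_const_inequality:
  assumes "cmod w < 1"
  shows "2 * (cmod (a + w * b))\<^sup>2 \<le> littlewood_const w * (cmod a)\<^sup>2 + (cmod (w * b))\<^sup>2 + (cmod b)\<^sup>2"
proof -
  define x y q where "x = cmod a" and "y = cmod b" and "q = cmod w"
  have q: "0 \<le> q" "q\<^sup>2 < 1"
    using assms by (auto simp: q_def abs_square_less_1)
  \<comment> \<open>After the triangle inequality, the gap between the two sides is a quadratic form
    in \<open>x\<close> and \<open>y\<close>; times \<open>1 - q^2\<close> it is this perfect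
    square.\<close>
  have "0 \<le> (2 * q * x - (1 - q\<^sup>2) * y)\<^sup>2"
    by simp
  also have "\<dots> = (1 - q\<^sup>2) * (4 * q\<^sup>2 / (1 - q\<^sup>2) * x\<^sup>2 + (1 - q\<^sup>2) * y\<^sup>2 - 4 * q * x * y)"
    using q by (simp add: field_simps power2_eq_square)
  finally have "0 \<le> 4 * q\<^sup>2 / (1 - q\<^sup>2) * x\<^sup>2 + (1 - q\<^sup>2) * y\<^sup>2 - 4 * q * x * y"
    using q by (simp add: zero_le_mult_iff)
  moreover have "(cmod (a + w * b))\<^sup>2 \<le> (x + q * y)\<^sup>2"
    unfolding x_def y_def q_def by (intro power_mono norm_triangle_mono) (auto simp: norm_mult)
  ultimately show ?thesis
    unfolding littlewood_const_def norm_mult power_mult_distrib x_def[symmetric] y_def[symmetric] q_def[symmetric]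
    by (simp add: algebra_simps power2_eq_square)
qed

lemma square_summable_coeff: "square_summable (coeff p)"
  by (rule summable_finite[of "{..degree p}"]) (auto simp: coeff_eq_0)

text \<open>
  The value at \<open>\<phi> 0\<close> is carried along on the left: writing \<open>P = a + z * p\<close>, the norm of \<open>P \<circ> \<phi>\<close>
  differs from that of \<open>\<phi> * (p \<circ> \<phi>)\<close> only in the constant coefficient, where \<open>p (\<phi> 0)\<close> enters,
  and \<open>littlewood_const\<close> is the least factor that absorbs this term.
\<close>

lemma littlewood_poly:
  assumes \<phi>: "\<phi> holomorphic_on unit_disk" "\<phi> ` unit_disk \<subseteq> unit_disk"
  shows "square_summable (taylor_coeff (\<lambda>z. poly p (\<phi> z))) \<and>
         sq_norm (taylor_coeff (\<lambda>z. poly p (\<phi> z))) + (cmod (poly p (\<phi> 0)))\<^sup>2 \<le>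
           littlewood_const (\<phi> 0) * sq_norm (coeff p)"
proof (induction p)
  case 0
  then show ?case by (simp add: taylor_coeff_const)
next
  case (pCons a p)
  let ?g = "\<lambda>z. poly p (\<phi> z)" and ?w = "\<phi> 0"
  let ?F = "\<lambda>z. \<phi> z * ?g z"
  define c where "c = taylor_coeff ?F"
  define d where "d = taylor_coeff (\<lambda>z. poly (pCons a p) (\<phi> z))"
  have g: "?g holomorphic_on unit_disk"
    unfolding poly_altdef by (intro holomorphic_intros \<phi>)
  then have F: "?F holomorphic_on unit_disk"
    by (intro holomorphic_intros \<phi>)
  have w: "cmod ?w < 1"
    using \<phi>(2)[THEN subsetD, OF imageI, of 0] by simp
  have "cmod (\<phi> z) \<le> 1" if "z \<in> unit_disk" for z
    using \<phi>(2) that by (force simp: less_imp_le)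
  from H2_multiplier_contraction[OF \<phi>(1) this g] pCons.IH
  have c: "square_summable c" "sq_norm c \<le> sq_norm (taylor_coeff ?g)"
    by (auto simp: c_def)
  have d: "d = (\<lambda>n. (if n = 0 then a else 0) + c n)"
    unfolding d_def c_def poly_pCons
    by (subst taylor_coeff_add) (auto simp: F taylor_coeff_const)
  have c0: "c 0 = ?w * ?g 0"
    by (simp add: c_def taylor_coeff_0)
  have "(\<lambda>n. (cmod (c (Suc n)))\<^sup>2) sums (sq_norm c - (cmod (c 0))\<^sup>2)"
    by (subst sums_Suc_iff[of "\<lambda>n. (cmod (c n))\<^sup>2"]) (use summable_sums[OF c(1)] in simp)
  then have "(\<lambda>n. (cmod (d (Suc n)))\<^sup>2) sums (sq_norm c - (cmod (c 0))\<^sup>2)"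
    by (simp add: d)
  then have "(\<lambda>n. (cmod (d n))\<^sup>2) sums (sq_norm c - (cmod (c 0))\<^sup>2 + (cmod (d 0))\<^sup>2)"
    by (rule sums_Suc_iff[THEN iffD1])
  then have d_sum: "square_summable d" "sq_norm d = sq_norm c - (cmod (?w * ?g 0))\<^sup>2 + (cmod (a + ?w * ?g 0))\<^sup>2"
    by (simp_all add: sums_iff d c0)
  have "sq_norm (coeff (pCons a p)) = (cmod a)\<^sup>2 + sq_norm (coeff p)"
    using suminf_split_head[OF square_summable_coeff[of "pCons a p"]] by (simp add: coeff_pCons)
  \<comment> \<open>The number \<open>a + ?w * ?g 0\<close> is both the constant coefficient of
    \<open>d\<close> and the value at \<open>?w\<close> of the new polynomial. Its square thus
    counts twice, which explains the factor 2 in \<open>littlewood_const_inequality\<close>.\<close>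
  then have "sq_norm d + (cmod (a + ?w * ?g 0))\<^sup>2 \<le> littlewood_const ?w * sq_norm (coeff (pCons a p))"
    using littlewood_const_inequality[OF w, of a "?g 0"] d_sum(2) c(2) pCons.IH
    by (simp add: algebra_simps)
  with d_sum(1) show ?case
    by (simp add: d_def)
qed

lemma littlewood_const_nonneg:
  assumes "cmod w < 1"
  shows "0 \<le> littlewood_const w"
  using assms by (auto simp: littlewood_const_def abs_square_le_1 intro!: add_nonneg_nonneg divide_nonneg_nonneg)

text \<open>Finite sums of powers are the shape in which Taylor partial sums are composed with
  \<open>\<phi>\<close>. The value at \<open>\<phi> 0\<close>, which carried the induction, is
  dropped here.\<close>

lemma littlewood_sum:
  assumes \<phi>: "\<phi> holomorphic_on unit_disk" "\<phi> ` unit_disk \<subseteq> unit_disk"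
  shows "square_summable (taylor_coeff (\<lambda>z. \<Sum>k<N. a k * \<phi> z ^ k))"
    and "sq_norm (taylor_coeff (\<lambda>z. \<Sum>k<N. a k * \<phi> z ^ k)) \<le>
           littlewood_const (\<phi> 0) * (\<Sum>k<N. (cmod (a k))\<^sup>2)"
proof -
  define p where "p = (\<Sum>k<N. monom (a k) k)"
  have coeff: "coeff p n = (if n < N then a n else 0)" for n
    by (simp add: p_def coeff_sum)
  have eq: "(\<lambda>z. \<Sum>k<N. a k * \<phi> z ^ k) = (\<lambda>z. poly p (\<phi> z))"
    by (simp add: p_def poly_sum poly_monom)
  have norm: "sq_norm (coeff p) = (\<Sum>k<N. (cmod (a k))\<^sup>2)"
    by (subst suminf_finite[of "{..<N}"]) (auto simp: coeff)
  note poly = littlewood_poly[OF \<phi>, of p, unfolded norm]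
  show "square_summable (taylor_coeff (\<lambda>z. \<Sum>k<N. a k * \<phi> z ^ k))"
    unfolding eq using poly by blast
  show "sq_norm (taylor_coeff (\<lambda>z. \<Sum>k<N. a k * \<phi> z ^ k)) \<le>
          littlewood_const (\<phi> 0) * (\<Sum>k<N. (cmod (a k))\<^sup>2)"
    unfolding eq using conjunct2[OF poly] zero_le_power2[of "cmod (poly p (\<phi> 0))"] by linarith
qed

text \<open>Compactness puts the image of the closed disk of radius 1/2 into some
  \<open>cball 0 \<rho>\<close> with \<open>\<rho> < 1\<close>, where the Taylor series of
  \<open>f\<close> converges uniformly. Locally uniform limits of holomorphic functions commute with
  derivatives at \<open>0\<close>.\<close>

lemma taylor_coeff_partial_sums_compose:
  assumes \<phi>: "\<phi> holomorphic_on unit_disk" "\<phi> ` unit_disk \<subseteq> unit_disk" and f: "f holomorphic_on unit_disk"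
  shows "(\<lambda>N. taylor_coeff (\<lambda>z. \<Sum>k<N. taylor_coeff f k * \<phi> z ^ k) n) \<longlonglongrightarrow> taylor_coeff (f \<circ> \<phi>) n"
proof -
  have "continuous_on (cball 0 (1/2)) \<phi>"
    by (intro holomorphic_on_imp_continuous_on holomorphic_on_subset[OF \<phi>(1)]) auto
  then have "compact (\<phi> ` cball 0 (1/2))"
    by (rule compact_continuous_image) simp
  moreover have sub: "\<phi> ` cball 0 (1/2) \<subseteq> unit_disk"
    using \<phi>(2) by (force simp: subset_iff image_iff)
  ultimately obtain \<rho> where \<rho>: "\<rho> < 1" "\<phi> ` cball 0 (1/2) \<subseteq> cball 0 \<rho>"
  proof -
    obtain z where "z \<in> \<phi> ` cball 0 (1/2)" "\<forall>y\<in>\<phi> ` cball 0 (1/2). norm y \<le> norm z"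
      using continuous_attains_sup[OF \<open>compact _\<close>, of norm] by (auto intro!: continuous_intros)
    then show thesis
      using sub by (intro that[of "norm z"]) (auto simp: subset_iff)
  qed
  have "uniform_limit (ball 0 (1/2)) (\<lambda>N z. \<Sum>k<N. taylor_coeff f k * \<phi> z ^ k) (\<lambda>z. f (\<phi> z)) sequentially"
    by (rule uniform_limit_compose'[OF taylor_uniform_limit[OF f \<rho>(1)]])
       (use \<rho>(2) in \<open>force simp: subset_iff\<close>)
  then have "(\<lambda>N. (deriv ^^ n) (\<lambda>z. \<Sum>k<N. taylor_coeff f k * \<phi> z ^ k) 0) \<longlonglongrightarrow> (deriv ^^ n) (\<lambda>z. f (\<phi> z)) 0"
    by (rule higher_deriv_complex_uniform_limit)
       (auto intro!: always_eventually holomorphic_intros holomorphic_on_subset[OF \<phi>(1)])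
  then show ?thesis
    unfolding taylor_coeff_eq_deriv o_def by (intro tendsto_divide) auto
qed

text \<open>A Fatou argument: the bound for the partial sums is uniform in \<open>N\<close>, so for
  the first \<open>M\<close> coefficients it survives the coefficientwise limit, and
  \<open>M\<close> is arbitrary.\<close>

lemma littlewood_subordination:
  assumes \<phi>: "\<phi> holomorphic_on unit_disk" "\<phi> ` unit_disk \<subseteq> unit_disk"
    and f: "f holomorphic_on unit_disk" "square_summable (taylor_coeff f)"
  shows "square_summable (taylor_coeff (f \<circ> \<phi>))"
    and "sq_norm (taylor_coeff (f \<circ> \<phi>)) \<le> littlewood_const (\<phi> 0) * sq_norm (taylor_coeff f)"
proof -
  have w: "cmod (\<phi> 0) < 1"
    using \<phi>(2)[THEN subsetD, OF imageI, of 0] by simp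
  define s where "s = (\<lambda>N. taylor_coeff (\<lambda>z. \<Sum>k<N. taylor_coeff f k * \<phi> z ^ k))"
  have s: "(\<Sum>n<M. (cmod (s N n))\<^sup>2) \<le> littlewood_const (\<phi> 0) * sq_norm (taylor_coeff f)" for M N
  proof -
    have "(\<Sum>n<M. (cmod (s N n))\<^sup>2) \<le> sq_norm (s N)"
      unfolding s_def by (intro sum_le_suminf_sq littlewood_sum \<phi>)
    also have "\<dots> \<le> littlewood_const (\<phi> 0) * (\<Sum>k<N. (cmod (taylor_coeff f k))\<^sup>2)"
      unfolding s_def by (intro littlewood_sum \<phi>)
    also have "\<dots> \<le> littlewood_const (\<phi> 0) * sq_norm (taylor_coeff f)"
      by (intro mult_left_mono sum_le_suminf_sq f littlewood_const_nonneg w)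
    finally show ?thesis .
  qed
  have "(\<Sum>n<M. (cmod (taylor_coeff (f \<circ> \<phi>) n))\<^sup>2) \<le> littlewood_const (\<phi> 0) * sq_norm (taylor_coeff f)" for M
  proof (rule LIMSEQ_le_const2)
    show "(\<lambda>N. \<Sum>n<M. (cmod (s N n))\<^sup>2) \<longlonglongrightarrow> (\<Sum>n<M. (cmod (taylor_coeff (f \<circ> \<phi>) n))\<^sup>2)"
      unfolding s_def by (intro tendsto_intros taylor_coeff_partial_sums_compose \<phi> f)
  qed (use s in auto)
  then show "square_summable (taylor_coeff (f \<circ> \<phi>))"
    "sq_norm (taylor_coeff (f \<circ> \<phi>)) \<le> littlewood_const (\<phi> 0) * sq_norm (taylor_coeff f)"
    by (rule square_summable_bounded_sums)+
qed

section \<open>Square-summable sequences: Cauchy-Schwarz and weak convergence\<close>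

abbreviation l2_inner :: "(nat \<Rightarrow> complex) \<Rightarrow> (nat \<Rightarrow> complex) \<Rightarrow> complex" where
  "l2_inner a b \<equiv> (\<Sum>n. a n * cnj (b n))"

lemma l2_summable:
  assumes "square_summable a" "square_summable b"
  shows "summable (\<lambda>n. a n * cnj (b n))"
proof (rule summable_comparison_test')
  show "summable (\<lambda>n. (cmod (a n))\<^sup>2 + (cmod (b n))\<^sup>2)"
    by (intro summable_add assms)
  show "norm (a n * cnj (b n)) \<le> (cmod (a n))\<^sup>2 + (cmod (b n))\<^sup>2" for n
  proof -
    have "2 * cmod (a n) * cmod (b n) \<le> (cmod (a n))\<^sup>2 + (cmod (b n))\<^sup>2"
      by (rule sum_squares_bound)
    moreover have "0 \<le> cmod (a n) * cmod (b n)" by simp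
    ultimately show ?thesis
      unfolding norm_mult complex_mod_cnj by linarith
  qed
qed

lemma l2_cauchy_schwarz:
  assumes "square_summable a" "square_summable b"
  shows "(cmod (l2_inner a b))\<^sup>2 \<le> sq_norm a * sq_norm b"
proof (rule LIMSEQ_le_const2)
  show "(\<lambda>N. (cmod (\<Sum>n<N. a n * cnj (b n)))\<^sup>2) \<longlonglongrightarrow> (cmod (l2_inner a b))\<^sup>2"
    by (intro tendsto_intros summable_LIMSEQ l2_summable assms)
  have "(cmod (\<Sum>n<N. a n * cnj (b n)))\<^sup>2 \<le> sq_norm a * sq_norm b" for N
  proof -
    have "(cmod (\<Sum>n<N. a n * cnj (b n)))\<^sup>2 \<le> (\<Sum>n<N. cmod (a n) * cmod (b n))\<^sup>2"
      by (intro power_mono sum_norm_le) (auto simp: norm_mult)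
    also have "\<dots> \<le> (\<Sum>n<N. (cmod (a n))\<^sup>2) * (\<Sum>n<N. (cmod (b n))\<^sup>2)"
      by (rule Cauchy_Schwarz_ineq_sum)
    also have "\<dots> \<le> sq_norm a * sq_norm b"
      by (intro mult_mono sum_le_suminf_sq assms sum_nonneg suminf_nonneg) auto
    finally show ?thesis .
  qed
  then show "\<exists>N. \<forall>n\<ge>N. (cmod (\<Sum>k<n. a k * cnj (b k)))\<^sup>2 \<le> sq_norm a * sq_norm b"
    by blast
qed

text \<open>The pairing is split at an index \<open>M\<close>. The tail is small uniformly in
  \<open>k\<close> by Cauchy-Schwarz and the norm bound, the head because it consists of finitely
  many null sequences.\<close>

lemma l2_weak_convergence:
  assumes u: "\<And>k. square_summable (u k)" "\<And>k. sq_norm (u k) \<le> C"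
    and lim: "\<And>n. (\<lambda>k. u k n) \<longlonglongrightarrow> 0" and b: "square_summable b"
  shows "(\<lambda>k. l2_inner (u k) b) \<longlonglongrightarrow> 0"
proof (rule LIMSEQ_I)
  fix e :: real assume e: "e > 0"
  have C: "0 \<le> C"
    using u(2)[of 0] suminf_nonneg[OF u(1)[of 0]] by simp
  \<comment> \<open>The threshold makes \<open>C + 1\<close> times the tail of \<open>b\<close> less
    than \<open>(e / 2)^2\<close>; \<open>C + 1\<close> replaces \<open>C\<close> to have a positive
    denominator.\<close>
  obtain M where M: "(\<Sum>n. (cmod (b (n + M)))\<^sup>2) < (e / 2)\<^sup>2 / (C + 1)"
  proof -
    have "0 < (e / 2)\<^sup>2 / (C + 1)" using e C by simp
    from suminf_exist_split[OF this b]
    obtain N where "\<And>n. n \<ge> N \<Longrightarrow> \<bar>\<Sum>i. (cmod (b (i + n)))\<^sup>2\<bar> < (e / 2)\<^sup>2 / (C + 1)"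
      by auto
    from this[of N] show thesis
      by (intro that[of N]) simp
  qed
  have "(\<lambda>k. \<Sum>n<M. u k n * cnj (b n)) \<longlonglongrightarrow> (\<Sum>n<M. 0 * cnj (b n))"
    by (intro tendsto_intros lim)
  then obtain K where K: "\<And>k. k \<ge> K \<Longrightarrow> cmod (\<Sum>n<M. u k n * cnj (b n)) < e / 2"
    using LIMSEQ_D[of _ 0 "e / 2"] e by auto
  have "cmod (l2_inner (u k) b) < e" if "k \<ge> K" for k
  proof -
    have sum: "square_summable (\<lambda>n. u k (n + M))" "square_summable (\<lambda>n. b (n + M))"
      using summable_ignore_initial_segment[OF u(1)[of k], of M] summable_ignore_initial_segment[OF b, of M]
      by auto
    have "sq_norm (\<lambda>n. u k (n + M)) \<le> sq_norm (u k)"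
      using suminf_split_initial_segment[OF u(1)[of k], of M] by (simp add: sum_nonneg)
    then have "sq_norm (\<lambda>n. u k (n + M)) \<le> C + 1"
      using u(2)[of k] by simp
    then have "(cmod (l2_inner (\<lambda>n. u k (n + M)) (\<lambda>n. b (n + M))))\<^sup>2 \<le> (C + 1) * sq_norm (\<lambda>n. b (n + M))"
      by (intro order_trans[OF l2_cauchy_schwarz[OF sum]] mult_right_mono suminf_nonneg sum) auto
    also have "\<dots> < (e / 2)\<^sup>2"
      using M C by (simp add: field_simps)
    finally have "cmod (\<Sum>n. u k (n + M) * cnj (b (n + M))) < e / 2"
      by (rule power_less_imp_less_base) (use e in simp)
    moreover have "l2_inner (u k) b = (\<Sum>n. u k (n + M) * cnj (b (n + M))) + (\<Sum>n<M. u k n * cnj (b n))"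
      by (rule suminf_split_initial_segment[OF l2_summable[OF u(1) b]])
    ultimately show ?thesis
      using K[OF that] norm_triangle_ineq[of "\<Sum>n. u k (n + M) * cnj (b (n + M))" "\<Sum>n<M. u k n * cnj (b n)"]
      by simp
  qed
  then show "\<exists>K. \<forall>k\<ge>K. norm (l2_inner (u k) b - 0) < e"
    by auto
qed

text \<open>The crude factor 2 is enough, as \<open>l2_weak_convergence\<close> asks only for some
  uniform bound.\<close>

lemma square_summable_diff:
  assumes "square_summable a" "square_summable b"
  shows "square_summable (\<lambda>n. a n - b n)"
    and "sq_norm (\<lambda>n. a n - b n) \<le> 2 * sq_norm a + 2 * sq_norm b"
proof -
  have le: "(cmod (a n - b n))\<^sup>2 \<le> 2 * (cmod (a n))\<^sup>2 + 2 * (cmod (b n))\<^sup>2" for n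
  proof -
    have "(cmod (a n - b n))\<^sup>2 \<le> (cmod (a n) + cmod (b n))\<^sup>2"
      by (intro power_mono norm_triangle_ineq4) auto
    also have "\<dots> \<le> 2 * (cmod (a n))\<^sup>2 + 2 * (cmod (b n))\<^sup>2"
      using sum_squares_bound[of "cmod (a n)" "cmod (b n)"] by (simp add: power2_sum)
    finally show ?thesis .
  qed
  have sums: "(\<lambda>n. 2 * (cmod (a n))\<^sup>2 + 2 * (cmod (b n))\<^sup>2) sums (2 * sq_norm a + 2 * sq_norm b)"
    by (intro sums_add sums_mult summable_sums assms)
  show *: "square_summable (\<lambda>n. a n - b n)"
    by (rule summable_comparison_test'[OF sums_summable[OF sums], of 0]) (use le in simp)
  show "sq_norm (\<lambda>n. a n - b n) \<le> 2 * sq_norm a + 2 * sq_norm b"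
    by (rule sums_le[OF le summable_sums[OF *] sums])
qed

text \<open>The power series is the pairing of \<open>a\<close> with the square-summable geometric
  sequence \<open>cnj z ^ n\<close>.\<close>

lemma square_summable_power_series:
  assumes "square_summable a" "z \<in> unit_disk"
  shows "summable (\<lambda>n. a n * z ^ n)"
proof -
  have "summable (\<lambda>n. ((cmod z)\<^sup>2) ^ n)"
    using assms(2) by (intro summable_geometric) (simp add: abs_square_less_1)
  then have "square_summable (\<lambda>n. cnj z ^ n)"
    by (simp add: norm_power power_mult[symmetric] mult.commute)
  from l2_summable[OF assms(1) this] show ?thesis by simp
qed

section \<open>The Hardy space as a sequence space, and the adjoint of a composition
  operator\<close>

lemma H2_of_square_summable:
  assumes "square_summable a"
  obtains h where "h \<in> H2" "taylor_coeff h = a"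
proof
  let ?h = "\<lambda>z. \<Sum>n. a n * z ^ n"
  have sums: "(\<lambda>n. a n * z ^ n) sums ?h z" if "z \<in> unit_disk" for z
    by (intro summable_sums square_summable_power_series assms that)
  then have "taylor_coeff ?h = a"
    by (rule taylor_coeff_unique)
  then show "taylor_coeff (on_disk ?h) = a" by simp
  show "on_disk ?h \<in> H2"
    using assms holomorphic_of_power_series[OF sums] \<open>taylor_coeff ?h = a\<close>
    by (simp add: on_disk_in_H2_iff)
qed

lemma H2_D:
  assumes "f \<in> H2"
  shows "f holomorphic_on unit_disk" "square_summable (taylor_coeff f)"
  using assms by (auto simp: H2_def)

lemma H2_eqI:
  assumes "f \<in> H2" "g \<in> H2" "taylor_coeff f = taylor_coeff g"
  shows "f = g"
proof
  fix z
  show "f z = g z"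
  proof (cases "z \<in> unit_disk")
    case True
    then show ?thesis
      using taylor_series_sums[of f z] taylor_series_sums[of g z] assms(3) H2_D(1)[OF assms(1)] H2_D(1)[OF assms(2)]
      by (auto dest: sums_unique2)
  next
    case False
    then show ?thesis using assms(1,2) by (auto simp: H2_def)
  qed
qed

lemma taylor_coeff_comp_op [simp]: "taylor_coeff (comp_op \<phi> f) = taylor_coeff (f \<circ> \<phi>)"
  by (simp add: comp_op_def)

lemma poly_in_H2: "on_disk (poly p) \<in> H2"
  by (auto simp: on_disk_in_H2_iff taylor_coeff_poly square_summable_coeff poly_altdef intro!: holomorphic_intros)

text \<open>Pairing with the monomials reads off the conjugated coefficients. This yields the
  uniqueness behind the \<open>THE\<close> in \<open>H2_adjoint\<close>.\<close>

lemma H2_inner_separating: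
  assumes "h \<in> H2" "h' \<in> H2" "\<And>f. f \<in> H2 \<Longrightarrow> H2_inner f h = H2_inner f h'"
  shows "h = h'"
proof (rule H2_eqI[OF assms(1,2)], rule ext)
  fix n
  have "H2_inner (on_disk (poly (monom 1 n))) g = cnj (taylor_coeff g n)" for g
    unfolding H2_inner_def taylor_coeff_on_disk taylor_coeff_poly
    by (subst suminf_finite[of "{n}"]) auto
  then show "taylor_coeff h n = taylor_coeff h' n"
    using assms(3)[OF poly_in_H2] by (metis complex_cnj_cnj)
qed

text \<open>The adjoint is constructed through its coefficients: they are forced by testing on
  monomials, shown square-summable by duality, and the identity extends from polynomials to all
  \<open>f\<close> by weak convergence.\<close>

lemma comp_op_adjoint_exists:
  assumes \<phi>: "\<phi> holomorphic_on unit_disk" "\<phi> ` unit_disk \<subseteq> unit_disk" and g: "g \<in> H2"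
  shows "\<exists>h\<in>H2. \<forall>f\<in>H2. H2_inner (comp_op \<phi> f) g = H2_inner f h"
proof -
  define b where "b = taylor_coeff g"
  define s where "s = (\<lambda>a N. taylor_coeff (\<lambda>z. \<Sum>k<N. a k * \<phi> z ^ k))"
  \<comment> \<open>Testing on the monomial of degree \<open>k\<close> leaves this as the only
    possible coefficient of \<open>h\<close>.\<close>
  define \<eta> where "\<eta> = (\<lambda>k. cnj (l2_inner (taylor_coeff (\<lambda>z. \<phi> z ^ k)) b))"
  let ?A = "littlewood_const (\<phi> 0)"
  have b: "square_summable b"
    using H2_D[OF g] by (simp add: b_def)
  have A: "0 \<le> ?A"
    using \<phi>(2)[THEN subsetD, OF imageI, of 0] by (intro littlewood_const_nonneg) simp
  have pow: "square_summable (taylor_coeff (\<lambda>z. \<phi> z ^ k))" for k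
    using littlewood_sum(1)[OF \<phi>, of "\<lambda>i. if i = k then 1 else 0" "Suc k"] by simp
  have cmult: "taylor_coeff (\<lambda>z. c * \<phi> z ^ k) n = c * taylor_coeff (\<lambda>z. \<phi> z ^ k) n" for c k n
    by (subst taylor_coeff_cmult) (auto intro!: holomorphic_intros \<phi>)
  have s_inner: "l2_inner (s a N) b = (\<Sum>k<N. a k * cnj (\<eta> k))" for a N
  proof -
    have "l2_inner (s a N) b = (\<Sum>n. \<Sum>k<N. a k * (taylor_coeff (\<lambda>z. \<phi> z ^ k) n * cnj (b n)))"
      unfolding s_def
      by (subst taylor_coeff_sum)
         (auto intro!: holomorphic_intros \<phi> simp: cmult sum_distrib_right mult.assoc)
    also have "\<dots> = (\<Sum>k<N. a k * cnj (\<eta> k))"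
      by (subst suminf_sum)
         (auto intro!: summable_mult l2_summable pow b simp: \<eta>_def suminf_mult[OF l2_summable[OF pow b]])
    finally show ?thesis .
  qed
  \<comment> \<open>Duality: the polynomial whose coefficients are \<open>\<eta>\<close> itself up
    to \<open>N\<close> pairs to \<open>S\<close>, while Cauchy-Schwarz and Littlewood bound
    \<open>S^2\<close> by a multiple of \<open>S\<close>; one factor \<open>S\<close>
    cancels.\<close>
  have "(\<Sum>k<N. (cmod (\<eta> k))\<^sup>2) \<le> ?A * sq_norm b" for N
  proof -
    define S where "S = (\<Sum>k<N. (cmod (\<eta> k))\<^sup>2)"
    have S: "0 \<le> S" by (simp add: S_def sum_nonneg)
    have "l2_inner (s \<eta> N) b = of_real S"
      unfolding s_inner S_def of_real_sum by (simp add: complex_norm_square del: of_real_power)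
    then have "S\<^sup>2 \<le> sq_norm (s \<eta> N) * sq_norm b"
      using l2_cauchy_schwarz[OF littlewood_sum(1)[OF \<phi>] b, of \<eta> N] by (simp add: s_def)
    also have "\<dots> \<le> ?A * S * sq_norm b"
      unfolding s_def S_def by (intro mult_right_mono littlewood_sum \<phi> suminf_nonneg b) auto
    finally have "S * S \<le> (?A * sq_norm b) * S"
      by (simp add: power2_eq_square mult_ac)
    then have "S \<le> ?A * sq_norm b"
      using S A suminf_nonneg[OF b] by (cases "S = 0") auto
    then show ?thesis by (simp add: S_def)
  qed
  from square_summable_bounded_sums(1)[OF this] have \<eta>: "square_summable \<eta>" .
  then obtain h where h: "h \<in> H2" "taylor_coeff h = \<eta>"
    by (rule H2_of_square_summable)
  have "H2_inner (comp_op \<phi> f) g = H2_inner f h" if f: "f \<in> H2" for f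
  proof -
    define a where "a = taylor_coeff f"
    define c where "c = taylor_coeff (f \<circ> \<phi>)"
    note f' = H2_D[OF f]
    have c: "square_summable c"
      unfolding c_def by (rule littlewood_subordination[OF \<phi> f'])
    have s: "square_summable (s a N)" for N
      unfolding s_def by (rule littlewood_sum[OF \<phi>])
    \<comment> \<open>The composed partial sums converge coefficientwise to \<open>c\<close> and are
      norm-bounded by Littlewood, so they converge weakly.\<close>
    have "(\<lambda>N. l2_inner (\<lambda>n. s a N n - c n) b) \<longlonglongrightarrow> 0"
    proof (rule l2_weak_convergence[OF square_summable_diff(1)[OF s c] _ _ b])
      fix N n
      have "sq_norm (s a N) \<le> ?A * (\<Sum>k<N. (cmod (a k))\<^sup>2)"
        unfolding s_def by (rule littlewood_sum[OF \<phi>])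
      also have "\<dots> \<le> ?A * sq_norm a"
        using f'(2) by (intro mult_left_mono sum_le_suminf_sq A) (simp add: a_def)
      finally show "sq_norm (\<lambda>n. s a N n - c n) \<le> 2 * (?A * sq_norm a) + 2 * sq_norm c"
        using square_summable_diff(2)[OF s c, of N] by simp
      have "(\<lambda>N. s a N n - c n) \<longlonglongrightarrow> c n - c n"
        unfolding s_def a_def c_def by (intro tendsto_intros taylor_coeff_partial_sums_compose \<phi> f')
      then show "(\<lambda>N. s a N n - c n) \<longlonglongrightarrow> 0" by simp
    qed
    also have "(\<lambda>N. l2_inner (\<lambda>n. s a N n - c n) b) = (\<lambda>N. (\<Sum>k<N. a k * cnj (\<eta> k)) - l2_inner c b)"
      by (simp add: left_diff_distrib suminf_diff[OF l2_summable[OF s b] l2_summable[OF c b], symmetric] flip: s_inner)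
    finally have "(\<lambda>N. \<Sum>k<N. a k * cnj (\<eta> k)) \<longlonglongrightarrow> l2_inner c b"
      by (simp add: LIM_zero_iff)
    moreover have "(\<lambda>N. \<Sum>k<N. a k * cnj (\<eta> k)) \<longlonglongrightarrow> l2_inner a \<eta>"
      using f'(2) by (intro summable_LIMSEQ l2_summable \<eta>) (simp add: a_def)
    ultimately have "l2_inner c b = l2_inner a \<eta>"
      by (rule LIMSEQ_unique)
    then show ?thesis
      by (simp add: H2_inner_def a_def b_def c_def h(2))
  qed
  with h(1) show ?thesis by blast
qed

text \<open>Existence and uniqueness together allow the definite description to be replaced by its
  defining property.\<close>

lemma H2_adjoint_comp_op_iff:
  assumes \<phi>: "\<phi> holomorphic_on unit_disk" "\<phi> ` unit_disk \<subseteq> unit_disk" and g: "g \<in> H2"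
  shows "H2_adjoint (comp_op \<phi>) g = h \<longleftrightarrow>
         h \<in> H2 \<and> (\<forall>f\<in>H2. H2_inner (comp_op \<phi> f) g = H2_inner f h)" (is "_ \<longleftrightarrow> ?P h")
proof -
  obtain h0 where h0: "?P h0"
    using comp_op_adjoint_exists[OF assms] by blast
  have unique: "h = h0" if "?P h" for h
    using that h0 by (intro H2_inner_separating) auto
  have "H2_adjoint (comp_op \<phi>) g = h0"
    unfolding H2_adjoint_def by (rule the_equality, rule h0, rule unique)
  then show ?thesis
    using h0 unique by blast
qed

section \<open>Powers of a selfmap, and the constant function 1\<close>

lemma taylor_coeff_power_tendsto_0:
  assumes \<psi>: "\<psi> holomorphic_on unit_disk" "\<psi> ` unit_disk \<subseteq> unit_disk"
  shows "(\<lambda>k. taylor_coeff (\<lambda>z. \<psi> z ^ k) n) \<longlonglongrightarrow> 0"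
proof -
  \<comment> \<open>The powers of \<open>\<psi>\<close> are the differences of consecutive partial
    sums of the geometric series composed with \<open>\<psi>\<close>. The coefficients of these
    partial sums converge, so their differences tend to 0.\<close>
  let ?f = "\<lambda>z::complex. 1 / (1 - z)" and ?s = "\<lambda>N. taylor_coeff (\<lambda>z. \<Sum>k<N. \<psi> z ^ k) n"
  have hol: "?f holomorphic_on unit_disk"
    by (intro holomorphic_intros) auto
  have "taylor_coeff ?f = (\<lambda>_. 1)"
    by (rule taylor_coeff_unique) (auto intro: geometric_sums)
  with taylor_coeff_partial_sums_compose[OF \<psi> hol, of n]
  have lim: "?s \<longlonglongrightarrow> taylor_coeff (?f \<circ> \<psi>) n"
    by simp
  from tendsto_diff[OF LIMSEQ_Suc[OF lim] lim]
  have "(\<lambda>N. ?s (Suc N) - ?s N) \<longlonglongrightarrow> 0"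
    by simp
  moreover have "?s (Suc N) - ?s N = taylor_coeff (\<lambda>z. \<psi> z ^ N) n" for N
    by (subst (1 2) taylor_coeff_sum) (auto intro!: holomorphic_intros \<psi>)
  ultimately show ?thesis by simp
qed

lemma H2_inner_one: "H2_inner f (on_disk (\<lambda>_. 1)) = f 0"
  unfolding H2_inner_def taylor_coeff_on_disk taylor_coeff_const
  by (subst suminf_finite[of "{0}"]) (auto simp: taylor_coeff_0)

lemma one_in_H2: "on_disk (\<lambda>_. 1) \<in> H2"
proof -
  have "poly [:1:] = (\<lambda>_. 1 :: complex)"
    by (simp add: fun_eq_iff)
  then show ?thesis
    using poly_in_H2[of "[:1:]"] by simp
qed

section \<open>The image of the disk under a zero-free linear-fractional selfmap\<close>

lemma cmod_sq_diff_identity: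
  "(cmod (b * cnj d - a * cnj c))\<^sup>2 - (cmod (a * d - b * c))\<^sup>2 =
     ((cmod b)\<^sup>2 - (cmod a)\<^sup>2) * ((cmod d)\<^sup>2 - (cmod c)\<^sup>2)"
  unfolding of_real_eq_iff[where 'a = complex, symmetric] of_real_diff of_real_mult complex_norm_square
  by (simp add: algebra_simps)

text \<open>With the pole off the closed disk, the image lies within distance
  \<open>cmod (a * d - b * c) / \<Delta>\<close> of a centre \<open>p\<close>, and having no zero
  forces this radius to be at most \<open>cmod p\<close>. Otherwise the pole has modulus 1.\<close>

lemma moebius_image_in_disk_avoiding_0:
  assumes c0: "\<And>z. z \<in> unit_disk \<Longrightarrow> c * z + d \<noteq> 0"
    and \<phi>: "\<And>z. z \<in> unit_disk \<Longrightarrow> \<phi> z = (a * z + b) / (c * z + d)"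
    and self: "\<phi> ` unit_disk \<subseteq> unit_disk"
    and nz: "\<And>z. z \<in> unit_disk \<Longrightarrow> \<phi> z \<noteq> 0"
  obtains p where "\<And>z. z \<in> unit_disk \<Longrightarrow> cmod (\<phi> z - p) < cmod p"
proof (cases "cmod c < cmod d")
  case True
  define \<Delta> where "\<Delta> = (cmod d)\<^sup>2 - (cmod c)\<^sup>2"
  have \<Delta>: "\<Delta> > 0"
    using True by (simp add: \<Delta>_def power_strict_mono)
  have ab: "cmod a \<le> cmod b"
  proof (rule ccontr)
    assume less: "\<not> cmod a \<le> cmod b"
    then have "a \<noteq> 0" by auto
    moreover from this less have "- b / a \<in> unit_disk"
      by (simp add: norm_divide divide_less_eq)
    ultimately show False using nz[of "- b / a"] \<phi>[of "- b / a"] by simp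
  qed
  \<comment> \<open>the centre of the image circle, being the value at the reflection \<open>- cnj (c / d)\<close> of the pole\<close>
  define p where "p = (b * cnj d - a * cnj c) / of_real \<Delta>"
  have diff: "\<phi> z - p = (a * d - b * c) * (cnj d * z + cnj c) / (of_real \<Delta> * (c * z + d))" if "z \<in> unit_disk" for z
  proof -
    have \<Delta>_eq: "of_real \<Delta> = d * cnj d - c * cnj c"
      by (simp add: \<Delta>_def complex_norm_square del: of_real_power)
    have "(a * z + b) * of_real \<Delta> - (b * cnj d - a * cnj c) * (c * z + d) =
               (a * d - b * c) * (cnj d * z + cnj c)"
      unfolding \<Delta>_eq by (simp add: algebra_simps)
    then show ?thesis
      using \<Delta> c0[OF that] unfolding \<phi>[OF that] p_def
      by (simp add: diff_frac_eq mult.commute)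
  qed
  have "cmod (\<phi> z - p) < cmod p" if z: "z \<in> unit_disk" for z
  proof (cases "a * d - b * c = 0")
    case True
    then show ?thesis using diff[OF z] nz[OF z] by auto
  next
    case False
    \<comment> \<open>The quotient of these two linear terms has modulus 1 on the unit circle and
      less than 1 inside, as the factor \<open>1 - (cmod z)^2\<close> shows.\<close>
    have "(cmod (cnj d * z + cnj c))\<^sup>2 < (cmod (c * z + d))\<^sup>2"
    proof -
      have "(cmod (c * z + d))\<^sup>2 - (cmod (cnj d * z + cnj c))\<^sup>2 = \<Delta> * (1 - (cmod z)\<^sup>2)"
        unfolding \<Delta>_def of_real_eq_iff[where 'a = complex, symmetric] of_real_diff of_real_mult of_real_1 complex_norm_square
        by (simp add: algebra_simps)
      also have "\<dots> > 0" using \<Delta> z by (simp add: abs_square_less_1)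
      finally show ?thesis by simp
    qed
    then have "cmod (cnj d * z + cnj c) < cmod (c * z + d)"
      by (rule power_less_imp_less_base) simp
    \<comment> \<open>Divided by \<open>\<Delta>\<close>, this says that the radius is at most the
      modulus of the centre; by \<open>cmod_sq_diff_identity\<close> it amounts to
      \<open>cmod a \<le> cmod b\<close>.\<close>
    moreover have "cmod (a * d - b * c) \<le> cmod (b * cnj d - a * cnj c)"
    proof (rule power2_le_imp_le)
      have "0 \<le> ((cmod b)\<^sup>2 - (cmod a)\<^sup>2) * \<Delta>"
        using ab \<Delta> by (simp add: power_mono)
      then show "(cmod (a * d - b * c))\<^sup>2 \<le> (cmod (b * cnj d - a * cnj c))\<^sup>2"
        using cmod_sq_diff_identity[of b d a c] unfolding \<Delta>_def by linarith
    qed simp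
    ultimately have "cmod (a * d - b * c) * cmod (cnj d * z + cnj c) < cmod (b * cnj d - a * cnj c) * cmod (c * z + d)"
      using False by (intro mult_le_less_imp_less) auto
    moreover have "0 < cmod (c * z + d)" using c0[OF z] by simp
    moreover have "cmod (\<phi> z - p) = cmod (a * d - b * c) * cmod (cnj d * z + cnj c) / (\<Delta> * cmod (c * z + d))"
      unfolding diff[OF z] norm_mult norm_divide using \<Delta> by simp
    moreover have "cmod p = cmod (b * cnj d - a * cnj c) / \<Delta>"
      unfolding p_def norm_divide using \<Delta> by simp
    ultimately show ?thesis
      using \<Delta> by (simp only:) (simp add: divide_less_eq mult_ac)
  qed
  then show thesis by (rule that)
next
  \<comment> \<open>the pole is on the unit circle, so boundedness makes it cancel and the map is constant\<close>
  case False
  have "c \<noteq> 0"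
    using False c0[of 0] by auto
  define w where "w = - d / c"
  have w: "cmod w \<le> 1" "c * w + d = 0"
    using False \<open>c \<noteq> 0\<close> by (auto simp: w_def norm_divide divide_simps)
  \<comment> \<open>The pole \<open>w\<close> is approached radially from inside, where \<phi> is
    bounded by 1. Since \<open>c * w + d = 0\<close>, the numerator vanishes at \<open>w\<close> as
    well.\<close>
  have "cmod (a * w + b) \<le> cmod (c * w + d)"
  proof (rule tendsto_le)
    show "((\<lambda>t. cmod (a * (of_real t * w) + b)) \<longlongrightarrow> cmod (a * w + b)) (at_left 1)"
      "((\<lambda>t. cmod (c * (of_real t * w) + d)) \<longlongrightarrow> cmod (c * w + d)) (at_left 1)"
      by (auto intro!: tendsto_eq_intros)
    have "cmod (a * (of_real t * w) + b) \<le> cmod (c * (of_real t * w) + d)" if "0 < t" "t < 1" for t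
    proof -
      have "t * cmod w < 1"
        using that w(1) mult_left_le[of "cmod w" t] by linarith
      then have z: "of_real t * w \<in> unit_disk"
        using that by (simp add: norm_mult)
      then have "cmod (\<phi> (of_real t * w)) < 1"
        using self by (auto simp: image_subset_iff)
      then show ?thesis
        using c0[OF z] unfolding \<phi>[OF z] norm_divide by (simp add: divide_simps)
    qed
    then show "\<forall>\<^sub>F t in at_left 1. cmod (a * (of_real t * w) + b) \<le> cmod (c * (of_real t * w) + d)"
      using eventually_at_left_real[of 0 1] by (auto elim!: eventually_mono)
  qed simp
  then have b: "b = - (a * w)" and d: "d = - (c * w)"
    using w(2) by (auto simp: eq_neg_iff_add_eq_0 add.commute)
  have const: "\<phi> z = a / c" if "z \<in> unit_disk" for z
  proof -
    have "a * z + b = a * (z - w)" "c * z + d = c * (z - w)"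
      unfolding b d by (simp_all add: algebra_simps)
    then show ?thesis
      using c0[OF that] unfolding \<phi>[OF that] by simp
  qed
  \<comment> \<open>The constant value serves as its own centre, and being nonzero it has positive
    modulus.\<close>
  show thesis
    by (rule that[of "a / c"]) (use const nz[of 0] in auto)
qed

section \<open>Reproducing kernels and the equivalence\<close>

lemma reproducing_kernel:
  assumes "\<beta> \<in> unit_disk"
  shows "on_disk (\<lambda>z. 1 / (1 - cnj \<beta> * z)) \<in> H2"
    and "f holomorphic_on unit_disk \<Longrightarrow> H2_inner f (on_disk (\<lambda>z. 1 / (1 - cnj \<beta> * z))) = f \<beta>"
proof -
  have sums: "(\<lambda>n. cnj \<beta> ^ n * z ^ n) sums (1 / (1 - cnj \<beta> * z))" if "z \<in> unit_disk" for z
  proof -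
    have "norm (cnj \<beta> * z) < 1"
      using assms that mult_strict_mono'[of "cmod \<beta>" 1 "cmod z" 1] by (simp add: norm_mult)
    from geometric_sums[OF this] show ?thesis by (simp add: power_mult_distrib)
  qed
  have coeff: "taylor_coeff (\<lambda>z. 1 / (1 - cnj \<beta> * z)) = (\<lambda>n. cnj \<beta> ^ n)"
    by (rule taylor_coeff_unique[OF sums])
  have "summable (\<lambda>n. ((cmod \<beta>)\<^sup>2) ^ n)"
    using assms by (intro summable_geometric) (simp add: abs_square_less_1)
  then have "square_summable (\<lambda>n. cnj \<beta> ^ n)"
    by (simp add: norm_power power_mult[symmetric] mult.commute)
  then show "on_disk (\<lambda>z. 1 / (1 - cnj \<beta> * z)) \<in> H2"
    using holomorphic_of_power_series[OF sums] by (simp add: on_disk_in_H2_iff coeff)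
  \<comment> \<open>Conjugation in the second slot turns \<open>cnj \<beta> ^ n\<close> into
    \<open>\<beta> ^ n\<close>, so the pairing is literally the Taylor series of \<open>f\<close> at
    \<open>\<beta>\<close>.\<close>
  show "H2_inner f (on_disk (\<lambda>z. 1 / (1 - cnj \<beta> * z))) = f \<beta>" if "f holomorphic_on unit_disk"
    using sums_unique[OF taylor_series_sums[OF that assms]]
    unfolding H2_inner_def taylor_coeff_on_disk coeff by simp
qed

theorem proposition1p3:
  fixes \<phi> :: "complex \<Rightarrow> complex"
  assumes "linear_fractional_selfmap \<phi>"
  shows "on_disk (\<lambda>_. 1) \<in> H2_adjoint (comp_op \<phi>) ` H2 \<longleftrightarrow> (\<exists>\<beta>\<in>ball 0 1. \<phi> \<beta> = 0)"
proof -
  obtain a b c d where c0: "\<And>z. z \<in> unit_disk \<Longrightarrow> c * z + d \<noteq> 0"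
    and mob: "\<And>z. z \<in> unit_disk \<Longrightarrow> \<phi> z = (a * z + b) / (c * z + d)"
    and self: "\<phi> ` unit_disk \<subseteq> unit_disk"
    using assms unfolding linear_fractional_selfmap_def moebius_def by blast
  have "(\<lambda>z. (a * z + b) / (c * z + d)) holomorphic_on unit_disk"
    using c0 by (intro holomorphic_intros) auto
  then have hol: "\<phi> holomorphic_on unit_disk"
    by (rule holomorphic_transform) (simp add: mob)
  \<comment> \<open>Pairing with 1 is evaluation at \<open>0\<close>, so being a preimage of 1
    becomes a condition on \<open>g\<close> alone.\<close>
  have adjoint: "H2_adjoint (comp_op \<phi>) g = on_disk (\<lambda>_. 1) \<longleftrightarrow>
                 (\<forall>f\<in>H2. H2_inner (comp_op \<phi> f) g = f 0)" if "g \<in> H2" for g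
    using H2_adjoint_comp_op_iff[OF hol self that] one_in_H2 by (simp add: H2_inner_one)
  show ?thesis
  proof
    assume "\<exists>\<beta>\<in>ball 0 1. \<phi> \<beta> = 0"
    then obtain \<beta> where \<beta>: "\<beta> \<in> unit_disk" "\<phi> \<beta> = 0" by blast
    have "H2_inner (comp_op \<phi> f) (on_disk (\<lambda>z. 1 / (1 - cnj \<beta> * z))) = f 0" if "f \<in> H2" for f
    proof -
      have "f \<circ> \<phi> holomorphic_on unit_disk"
        by (rule holomorphic_on_compose_gen[OF hol H2_D(1)[OF that] self])
      then have "comp_op \<phi> f holomorphic_on unit_disk"
        by (simp add: comp_op_def)
      from reproducing_kernel(2)[OF \<beta>(1) this] show ?thesis
        using \<beta> by (simp add: comp_op_def on_disk_def)
    qed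
    then show "on_disk (\<lambda>_. 1) \<in> H2_adjoint (comp_op \<phi>) ` H2"
      using adjoint reproducing_kernel(1)[OF \<beta>(1)] by (metis imageI)
  next
    assume "on_disk (\<lambda>_. 1) \<in> H2_adjoint (comp_op \<phi>) ` H2"
    then obtain g where g: "g \<in> H2" "\<And>f. f \<in> H2 \<Longrightarrow> H2_inner (comp_op \<phi> f) g = f 0"
      using adjoint by (metis imageE)
    show "\<exists>\<beta>\<in>ball 0 1. \<phi> \<beta> = 0"
    proof (rule ccontr)
      assume "\<not> ?thesis"
      then have "\<And>z. z \<in> unit_disk \<Longrightarrow> \<phi> z \<noteq> 0" by blast
      from moebius_image_in_disk_avoiding_0[OF c0 mob self this]
      obtain p where p: "\<And>z. z \<in> unit_disk \<Longrightarrow> cmod (\<phi> z - p) < cmod p" by metis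
      then have "p \<noteq> 0"
        using p[of 0] by force
      \<comment> \<open>The affine map sending \<open>w\<close> to \<open>1 - w / p\<close> carries
        the disk of radius \<open>cmod p\<close> around \<open>p\<close> onto the unit disk and its
        boundary point \<open>0\<close> to 1, so every power of it is 1 at \<open>0\<close>.\<close>
      define \<psi> where "\<psi> = (\<lambda>z. 1 - \<phi> z / p)"
      have \<psi>_hol: "\<psi> holomorphic_on unit_disk"
        unfolding \<psi>_def using \<open>p \<noteq> 0\<close> by (intro holomorphic_intros hol) auto
      have \<psi>: "cmod (\<psi> z) < 1" if "z \<in> unit_disk" for z
      proof -
        have "\<psi> z = - ((\<phi> z - p) / p)"
          using \<open>p \<noteq> 0\<close> by (simp add: \<psi>_def field_simps)
        then show ?thesis
          using p[OF that] \<open>p \<noteq> 0\<close> by (simp add: norm_divide)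
      qed
      let ?u = "\<lambda>k. taylor_coeff (\<lambda>z. \<psi> z ^ k)"
      have "l2_inner (?u k) (taylor_coeff g) = 1" for k
      proof -
        \<comment> \<open>This is the power of that affine map as an element of \<open>H2\<close>;
          composed with \<open>\<phi>\<close> it agrees with \<open>\<psi> ^ k\<close> on the disk,
          as \<phi> takes its values there.\<close>
        let ?q = "on_disk (poly ([:1, - 1 / p:] ^ k))"
        have "taylor_coeff (comp_op \<phi> ?q) = ?u k"
          unfolding taylor_coeff_comp_op
          by (rule taylor_coeff_cong) (use self in \<open>auto simp: on_disk_def \<psi>_def poly_power image_subset_iff\<close>)
        then have "l2_inner (?u k) (taylor_coeff g) = ?q 0"
          using g(2)[OF poly_in_H2, of "[:1, - 1 / p:] ^ k"] by (simp add: H2_inner_def)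
        then show ?thesis by (simp add: on_disk_def poly_power)
      qed
      moreover have "(\<lambda>k. l2_inner (?u k) (taylor_coeff g)) \<longlonglongrightarrow> 0"
      proof (rule l2_weak_convergence)
        show "square_summable (taylor_coeff g)"
          by (rule H2_D[OF g(1)])
        show "(\<lambda>k. ?u k n) \<longlonglongrightarrow> 0" for n
          by (rule taylor_coeff_power_tendsto_0[OF \<psi>_hol]) (use \<psi> in auto)
        fix k
        have "cmod (\<psi> z ^ k) \<le> 1" if "z \<in> unit_disk" for z
          using \<psi>[OF that] by (simp add: norm_power power_le_one)
        \<comment> \<open>The norm bound arises by letting the multiplier \<open>\<psi> ^ k\<close>
          act on the constant 1, which has norm 1.\<close>
        note * = H2_multiplier_contraction[OF holomorphic_on_power[OF \<psi>_hol] this,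
            where f = "on_disk (\<lambda>_. 1)", OF _ H2_D[OF one_in_H2]]
        have eq: "taylor_coeff (\<lambda>z. \<psi> z ^ k * on_disk (\<lambda>_. 1) z) = ?u k"
          by (rule taylor_coeff_cong) (simp add: on_disk_def)
        show "square_summable (?u k)"
          using *(1) by (simp add: eq)
        have "sq_norm (taylor_coeff (on_disk (\<lambda>_. 1))) = 1"
          unfolding taylor_coeff_on_disk taylor_coeff_const by (subst suminf_finite[of "{0}"]) auto
        then show "sq_norm (?u k) \<le> 1"
          using *(2) by (simp add: eq)
      qed
      ultimately show False
        using LIMSEQ_unique[OF tendsto_const, of "1::complex" 0] by simp
    qed
  qed
qed

end
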